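(* $\widehat{K}_{3,4}\notin\mathfrak{N}$.
   Context: All graphs are finite, without loops or multiple edges. An interval $t$-coloring of a graph $H$ is a proper edge-coloring of $H$ with colors $1,\ldots,t$ such that every color is used and for every vertex $v$ the set of colors of edges incident to $v$ is an interval of integers. $\mathfrak{N}$ denotes the set of graphs having an interval $t$-coloring for some positive integer $t$. $K_{3,4}$ is the complete bipartite graph with parts of sizes $3$ and $4$. For a graph $G$, $\widehat{G}$ is the graph obtained by subdividing every edge $v_iv_j$ of $G$ with a new vertex $w_{ij}$ (replacing $v_iv_j$ by $v_iw_{ij},v_jw_{ij}$) and then adding a new vertex $u$ adjacent to all the subdivision vertices $w_{ij}$. Thus $\widehat{K}_{3,4}$ is a bipartite graph with $20$ vertices and maximum degree $12$. *)

theory Defs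
  imports Main
begin

type_synonym 'a graph = "'a set \<times> 'a set set"

abbreviation verts :: "'a graph \<Rightarrow> 'a set" where
  "verts \<equiv> fst"

abbreviation edges :: "'a graph \<Rightarrow> 'a set set" where
  "edges \<equiv> snd"

definition simple_graph :: "'a graph \<Rightarrow> bool" where
  "simple_graph G \<longleftrightarrow> finite (verts G) \<and> (\<forall>e\<in>edges G. e \<subseteq> verts G \<and> card e = 2)"

definition incident_edges :: "'a graph \<Rightarrow> 'a \<Rightarrow> 'a set set" where
  "incident_edges G v = {e \<in> edges G. v \<in> e}"

definition proper_edge_coloring :: "'a graph \<Rightarrow> ('a set \<Rightarrow> nat) \<Rightarrow> bool" where
  "proper_edge_coloring G c \<longleftrightarrow>
     (\<forall>e\<in>edges G. \<forall>f\<in>edges G. e \<noteq> f \<and> e \<inter> f \<noteq> {} \<longrightarrow> c e \<noteq> c f)"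

text \<open>The colours at a vertex may form the empty interval (take \<open>b < a\<close>), which happens
  exactly at isolated vertices.\<close>

definition interval_coloring :: "'a graph \<Rightarrow> nat \<Rightarrow> ('a set \<Rightarrow> nat) \<Rightarrow> bool" where
  "interval_coloring G t c \<longleftrightarrow>
     proper_edge_coloring G c \<and>
     c ` edges G = {1..t} \<and>
     (\<forall>v\<in>verts G. \<exists>a b. c ` incident_edges G v = {a..b})"

definition interval_colorable_graphs :: "'a graph set" ("\<NN>") where
  "\<NN> = {G. simple_graph G \<and> (\<exists>t c. t > 0 \<and> interval_coloring G t c)}"

definition complete_bipartite :: "nat \<Rightarrow> nat \<Rightarrow> (nat + nat) graph" where
  "complete_bipartite m n =
     ({..<m} <+> {..<n}, {{Inl i, Inr j} | i j. i < m \<and> j < n})"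

text \<open>In the hat construction, \<open>Sub e\<close> is the vertex subdividing the edge \<open>e\<close> and \<open>Apex\<close> is the
  additional vertex \<open>u\<close>.\<close>

datatype 'a hat_vertex = Orig 'a | Sub "'a set" | Apex

definition hat :: "'a graph \<Rightarrow> 'a hat_vertex graph" where
  "hat G =
     (Orig ` verts G \<union> Sub ` edges G \<union> {Apex},
      {{Orig v, Sub e} | v e. e \<in> edges G \<and> v \<in> e} \<union> {{Apex, Sub e} | e. e \<in> edges G})"

lemma simple_graph_complete_bipartite: "simple_graph (complete_bipartite m n)"
  by (auto simp: simple_graph_def complete_bipartite_def)

lemma simple_graph_hat:
  assumes "simple_graph G"
  shows "simple_graph (hat G)"
proof -
  have "finite (edges G)"
    using assms finite_subset[of "edges G" "Pow (verts G)"]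
    by (auto simp: simple_graph_def)
  then show ?thesis
    using assms by (auto simp: simple_graph_def hat_def)
qed

lemma edges_complete_bipartite:
  "edges (complete_bipartite m n) = (\<lambda>(i, j). {Inl i, Inr j}) ` ({..<m} \<times> {..<n})"
  by (auto simp: complete_bipartite_def)

lemma card_edges_complete_bipartite: "card (edges (complete_bipartite m n)) = m * n"
  unfolding edges_complete_bipartite
  by (subst card_image) (auto simp: inj_on_def doubleton_eq_iff card_cartesian_product)

lemma card_verts_hat_complete_bipartite:
  "card (verts (hat (complete_bipartite m n))) = m + n + m * n + 1"
proof -
  let ?K = "complete_bipartite m n"
  have fE: "finite (edges ?K)"
    unfolding edges_complete_bipartite by simp
  have "card (Orig ` verts ?K) = m + n"
    by (subst card_image) (auto simp: inj_on_def complete_bipartite_def card_Plus)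
  moreover have "card (Sub ` edges ?K) = m * n"
    using card_edges_complete_bipartite[of m n] by (subst card_image) (auto simp: inj_on_def)
  moreover have "card (Orig ` verts ?K \<union> Sub ` edges ?K)
      = card (Orig ` verts ?K) + card (Sub ` edges ?K)"
    by (rule card_Un_disjoint) (use fE in \<open>auto simp: complete_bipartite_def\<close>)
  moreover have "card (insert Apex (Orig ` verts ?K \<union> Sub ` edges ?K))
      = Suc (card (Orig ` verts ?K \<union> Sub ` edges ?K))"
    by (rule card_insert_disjoint) (use fE in \<open>auto simp: complete_bipartite_def\<close>)
  ultimately show ?thesis
    by (simp add: hat_def)
qed

lemma degree_Apex_hat: "card (incident_edges (hat G) Apex) = card (edges G)"
proof -
  have "incident_edges (hat G) Apex = (\<lambda>e. {Apex, Sub e}) ` edges G"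
    by (auto simp: incident_edges_def hat_def)
  then show ?thesis
    by (simp add: card_image inj_on_def doubleton_eq_iff)
qed

end

theory Submission
  imports Defs
begin

text \<open>Write \<open>a e\<close> for the colour of the edge joining \<open>Sub e\<close> to the apex, and \<open>x e\<close>, \<open>y e\<close> for the
  colours of the edges joining \<open>Sub e\<close> to the two ends of \<open>e = {Inl i, Inr j}\<close>. At a vertex of
  degree \<open>d\<close> colours differ by less than \<open>d\<close>, so \<open>x e + y e\<close> differs from \<open>2 * a e\<close> by at most \<open>3\<close>.
  Choose \<open>e\<close> and \<open>f\<close> with the least and the greatest colour at the apex, so
  \<open>a f - a e = m * n - 1\<close>. Walking from the row of \<open>e\<close> to the column of \<open>f\<close> through the edge of
  \<open>K\<^bsub>m,n\<^esub>\<close> at their crossing gives \<open>y f - x e \<le> (n - 1) + 2 + (m - 1)\<close>, and likewise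
  \<open>x f - y e \<le> m + n\<close>. Adding the two yields \<open>2 * (m * n - 1) - 6 \<le> 2 * (m + n)\<close>, which fails
  for \<open>m = 3\<close>, \<open>n = 4\<close>.\<close>

text \<open>The interval of colours at \<open>v\<close> has at most as many elements as there are
  edges at \<open>v\<close>. Since \<open>d\<close> need only be an upper bound, the degree of an
  original vertex can be bounded through the size of an image, with no injectivity proof.\<close>

lemma interval_coloring_spread:
  assumes col: "interval_coloring G t c" and v: "v \<in> verts G"
    and deg: "finite (incident_edges G v)" "card (incident_edges G v) \<le> d"
    and e: "e \<in> incident_edges G v" and f: "f \<in> incident_edges G v"
  shows "c f < c e + d"
proof -
  obtain a b where ab: "c ` incident_edges G v = {a..b}"
    using col v unfolding interval_coloring_def by blast
  have "card {a..b} \<le> d"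
    using card_image_le[OF deg(1), of c] deg(2) ab by simp
  moreover have "c e \<in> {a..b}" "c f \<in> {a..b}"
    using e f ab by blast+
  ultimately show ?thesis
    by auto
qed

text \<open>Properness makes \<open>c\<close> injective on the edges at \<open>v\<close>, so the
  interval has exactly as many elements as there are edges. The conclusion is additive to avoid
  truncated subtraction.\<close>

lemma interval_coloring_extremes:
  assumes col: "interval_coloring G t c" and v: "v \<in> verts G"
    and ne: "incident_edges G v \<noteq> {}"
  obtains e f where "e \<in> incident_edges G v" "f \<in> incident_edges G v"
    "c f + 1 = c e + card (incident_edges G v)"
proof -
  obtain a b where ab: "c ` incident_edges G v = {a..b}"
    using col v unfolding interval_coloring_def by blast
  have "inj_on c (incident_edges G v)"
    using col unfolding interval_coloring_def proper_edge_coloring_def incident_edges_def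
    by (intro inj_onI) blast
  then have card: "card (incident_edges G v) = card {a..b}"
    using card_image ab by metis
  \<comment> \<open>An interval with \<open>b < a\<close> is empty; once this is excluded, both ends
    occur as colours.\<close>
  have "a \<le> b"
    using ne ab by (metis atLeastatMost_empty_iff image_is_empty)
  then have "a \<in> c ` incident_edges G v" "b \<in> c ` incident_edges G v"
    unfolding ab by simp_all
  then obtain e f where "e \<in> incident_edges G v" "f \<in> incident_edges G v" "c e = a" "c f = b"
    by auto
  then show thesis
    using that card \<open>a \<le> b\<close> by simp
qed

lemma incident_edges_hat_Orig:
  "incident_edges (hat G) (Orig v) = (\<lambda>e. {Orig v, Sub e}) ` incident_edges G v"
  by (auto simp: incident_edges_def hat_def)

lemma incident_edges_hat_Sub:
  assumes "e \<in> edges G"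
  shows "incident_edges (hat G) (Sub e) = insert {Apex, Sub e} ((\<lambda>v. {Orig v, Sub e}) ` e)"
  using assms by (auto simp: incident_edges_def hat_def)

lemma incident_edges_hat_Apex:
  "incident_edges (hat G) Apex = (\<lambda>e. {Apex, Sub e}) ` edges G"
  by (auto simp: incident_edges_def hat_def)

lemma incident_edges_complete_bipartite_Inl:
  assumes "i < m"
  shows "incident_edges (complete_bipartite m n) (Inl i) = (\<lambda>j. {Inl i, Inr j}) ` {..<n}"
  using assms by (auto simp: incident_edges_def complete_bipartite_def)

lemma incident_edges_complete_bipartite_Inr:
  assumes "j < n"
  shows "incident_edges (complete_bipartite m n) (Inr j) = (\<lambda>i. {Inl i, Inr j}) ` {..<m}"
  using assms by (auto simp: incident_edges_def complete_bipartite_def)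

lemma interval_coloring_hat_complete_bipartite_le:
  assumes col: "interval_coloring (hat (complete_bipartite m n)) t c" and pos: "0 < m" "0 < n"
  shows "m * n \<le> m + n + 4"
proof -
  let ?K = "complete_bipartite m n"
  define a where "a i j = c {Apex, Sub {Inl i, Inr j}}" for i j
  define x where "x i j = c {Orig (Inl i), Sub {Inl i, Inr j}}" for i j
  define y where "y i j = c {Orig (Inr j), Sub {Inl i, Inr j}}" for i j
  have row: "x i k < x i j + n" if "i < m" "j < n" "k < n" for i j k
    unfolding x_def
  proof (rule interval_coloring_spread[OF col, of "Orig (Inl i)"])
    show "Orig (Inl i) \<in> verts (hat ?K)"
      using that by (auto simp: hat_def complete_bipartite_def)
    show "card (incident_edges (hat ?K) (Orig (Inl i))) \<le> n"
      unfolding incident_edges_hat_Orig incident_edges_complete_bipartite_Inl[OF that(1)] image_image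
      by (rule order_trans[OF card_image_le]) simp_all
  qed (use that in \<open>auto simp: incident_edges_hat_Orig incident_edges_complete_bipartite_Inl\<close>)
  have column: "y k j < y i j + m" if "j < n" "i < m" "k < m" for i j k
    unfolding y_def
  proof (rule interval_coloring_spread[OF col, of "Orig (Inr j)"])
    show "Orig (Inr j) \<in> verts (hat ?K)"
      using that by (auto simp: hat_def complete_bipartite_def)
    show "card (incident_edges (hat ?K) (Orig (Inr j))) \<le> m"
      unfolding incident_edges_hat_Orig incident_edges_complete_bipartite_Inr[OF that(1)] image_image
      by (rule order_trans[OF card_image_le]) simp_all
  qed (use that in \<open>auto simp: incident_edges_hat_Orig incident_edges_complete_bipartite_Inr\<close>)
  have sub: "y i j \<le> x i j + 2" "x i j \<le> y i j + 2"
    "x i j + y i j \<le> 2 * a i j + 3" "2 * a i j \<le> x i j + y i j + 3"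
    if "i < m" "j < n" for i j
  proof -
    let ?e = "{Inl i, Inr j} :: (nat + nat) set"
    let ?A = "{Apex, Sub ?e}" and ?X = "{Orig (Inl i), Sub ?e}" and ?Y = "{Orig (Inr j), Sub ?e}"
    have e: "?e \<in> edges ?K"
      using that by (auto simp: complete_bipartite_def)
    have inc: "incident_edges (hat ?K) (Sub ?e) = {?A, ?X, ?Y}"
      using incident_edges_hat_Sub[OF e] by simp
    have "card {?A, ?X, ?Y} \<le> 3"
      by (simp add: card_insert_if)
    moreover have "Sub ?e \<in> verts (hat ?K)"
      using e by (simp add: hat_def)
    ultimately have near: "c g < c h + 3" if "g \<in> {?A, ?X, ?Y}" "h \<in> {?A, ?X, ?Y}" for g h
      using interval_coloring_spread[OF col, of "Sub ?e" 3 h g] that by (simp add: inc)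
    have in_edges: "{?A, ?X, ?Y} \<subseteq> edges (hat ?K)"
      unfolding inc[symmetric] by (auto simp: incident_edges_def)
    have apart: "c g \<noteq> c h" if "g \<in> {?A, ?X, ?Y}" "h \<in> {?A, ?X, ?Y}" "g \<noteq> h" for g h
    proof -
      have "Sub ?e \<in> g \<inter> h"
        using that by auto
      then show ?thesis
        using col \<open>g \<noteq> h\<close> subsetD[OF in_edges that(1)] subsetD[OF in_edges that(2)]
        unfolding interval_coloring_def proper_edge_coloring_def by blast
    qed
    have "a i j < x i j + 3" "x i j < a i j + 3" "a i j < y i j + 3" "y i j < a i j + 3"
      "x i j < y i j + 3" "y i j < x i j + 3"
      unfolding a_def x_def y_def by (rule near; simp)+
    moreover have "a i j \<noteq> x i j" "a i j \<noteq> y i j" "x i j \<noteq> y i j"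
      unfolding a_def x_def y_def by (rule apart; simp add: doubleton_eq_iff)+
    \<comment> \<open>The distinct numbers \<open>x i j\<close> and \<open>y i j\<close> both lie
      within 2 of \<open>a i j\<close>, so at most one of them is 2 away on a given side. This gives
      the constant 3 = 2 + 1.\<close>
    ultimately show "y i j \<le> x i j + 2" "x i j \<le> y i j + 2"
      "x i j + y i j \<le> 2 * a i j + 3" "2 * a i j \<le> x i j + y i j + 3"
      by linarith+
  qed
  have apex: "incident_edges (hat ?K) Apex
      = (\<lambda>(i, j). {Apex, Sub {Inl i, Inr j}}) ` ({..<m} \<times> {..<n})"
    unfolding incident_edges_hat_Apex edges_complete_bipartite image_image
    by (simp add: case_prod_unfold)
  obtain i j k l where ij: "i < m" "j < n" and kl: "k < m" "l < n" and far: "a k l + 1 = a i j + m * n"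
  proof (rule interval_coloring_extremes[OF col, of Apex])
    show "Apex \<in> verts (hat ?K)"
      by (simp add: hat_def)
    show "incident_edges (hat ?K) Apex \<noteq> {}"
      using pos by (auto simp: apex)
  next
    fix e f
    assume e: "e \<in> incident_edges (hat ?K) Apex" and f: "f \<in> incident_edges (hat ?K) Apex"
      and ef: "c f + 1 = c e + card (incident_edges (hat ?K) Apex)"
    obtain i j where ij: "i < m" "j < n" "e = {Apex, Sub {Inl i, Inr j}}"
      using e unfolding apex by auto
    obtain k l where kl: "k < m" "l < n" "f = {Apex, Sub {Inl k, Inr l}}"
      using f unfolding apex by auto
    have "a k l + 1 = a i j + m * n"
      using ef ij(3) kl(3) unfolding degree_Apex_hat card_edges_complete_bipartite a_def by simp
    with ij(1,2) kl(1,2) show thesis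
      by (rule that)
  qed
  \<comment> \<open>The first walk crosses at the pair \<open>(i, l)\<close>, the second at
    \<open>(k, j)\<close>. Since \<open>row\<close> and \<open>column\<close> admit equal indices,
    \<open>i = k\<close> and \<open>j = l\<close> need no separate case.\<close>
  have "y k l < y i l + m" "y i l \<le> x i l + 2" "x i l < x i j + n"
    by (rule column row sub; fact ij kl)+
  moreover have "x k l < x k j + n" "x k j \<le> y k j + 2" "y k j < y i j + m"
    by (rule column row sub; fact ij kl)+
  moreover have "x i j + y i j \<le> 2 * a i j + 3" "2 * a k l \<le> x k l + y k l + 3"
    by (rule sub; fact ij kl)+
  ultimately show ?thesis
    using far by linarith
qed

theorem theorem11:
  shows "hat (complete_bipartite 3 4) \<notin> \<NN>"
  \<comment> \<open>The bound would read 12 \<le> 11.\<close>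
  using interval_coloring_hat_complete_bipartite_le[of 3 4]
  by (auto simp: interval_colorable_graphs_def)

end
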